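(* Let $(X,\mathcal A)$ be a measurable space, $\mu$ a continuous monotone measure on $\mathcal A$, and $A\in\mathcal A$. Let $\circ\colon[0,\infty]\times[0,\infty]\to[0,\infty]$ be a nondecreasing map such that $a\circ0=0$ for all $a$. Let $H\colon[0,\infty]\to[0,\infty]$ and $f\colon X\to[0,\infty]$ be such that $f$ and $H(f)=H\circ f$ are $\mathcal A$-measurable, and suppose that $p:=\mathrm{Su}(f;A,\mu)<\infty$. (i) The following inequalities hold: $$\int_{\circ,A}H(f)\,\mathrm d\mu\ \ge\ \big[\inf H([p,\infty])\circ p\big]\vee\big[\inf H\circ\mu(A)\big],\qquad(1)$$ $$\int_{\circ,A}H(f)\,\mathrm d\mu\ \le\ \big[\sup H([0,p])\circ\mu(A)\big]\vee\big[\sup H\circ p\big].\qquad(2)$$ Equality holds in (1) for $f=\mu(A)\mathbf 1_A$ if (for the corresponding $p$) $H(p)=\inf H([p,\infty])$. Equality holds in (2) if $f=y_0\mathbf 1_A$, $H(p)=\sup H([0,p])$, and $y_0$ is such that $H(y_0)=\sup H$. (ii) If $\mu$ is weakly subadditive on $A$, then $$\int_{\circ,A}H(f)\,\mathrm d\mu\ \ge\ \big[\inf H([0,p])\circ(\mu(A)-p)\big]\vee\big[\inf H\circ\mu(A)\big].$$ Equality holds here for $f=y_0\mathbf 1_A$ if $H(p)=\inf H([0,p])$ and $y_0$ is such that $H(y_0)=\inf H$. (iii) If $\mu$ is weakly superadditive on $A$, then $$\int_{\circ,A}H(f)\,\mathrm d\mu\ \le\ \big[\sup H([p,\infty])\circ\mu(A)\big]\vee\big[\sup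 H\circ(\mu(A)-p)\big].$$ Equality holds here for $f=\mu(A)\mathbf 1_A$ if (for the corresponding $p$) $H(p)=\sup H([p,\infty])$.
   Context: A monotone measure on $\mathcal A$ is a set function $\mu\colon\mathcal A\to[0,\infty]$ with $\mu(\emptyset)=0$ and $\mu(B)\le\mu(C)$ whenever $B\subset C$. It is continuous from below (resp. from above) if $\lim_n\mu(A_n)=\mu(\lim_n A_n)$ for every sequence $A_n\in\mathcal A$ with $A_n\subset A_{n+1}$ (resp. $A_{n+1}\subset A_n$) for all $n$, where $\lim_nA_n$ is the union (resp. intersection); it is continuous if it is continuous both from below and from above. A binary map $\circ$ is nondecreasing if $a\circ b\le c\circ d$ whenever $a\le c$ and $b\le d$. Notation: $a\wedge b=\min(a,b)$, $a\vee b=\max(a,b)$; $\mathbf 1_A$ is the indicator function of $A$. Generalized Sugeno integral: for measurable $g\colon X\to[0,\infty]$, $$\int_{\circ,A}g\,\mathrm d\mu=\sup_{t\in[0,\infty]}\big\{t\circ\mu(A\cap\{g\ge t\})\big\},\qquad \{g\ge t\}=\{x\in X: g(x)\ge t\}.$$ Sugeno integral: $\mathrm{Su}(g;A,\mu)=\sup_{t\ge0}\{t\wedge\mu(A\cap\{g\ge t\})\}$. $\mu$ is weakly subadditive on $A$ if $\mu(A)\le\mu(A\cap B)+\mu(A\cap B^c)$ for all $B\in\mathcal A$, and weakly superadditive on $A$ if $\mu(A)\ge\mu(A\cap B)+\mu(A\cap B^c)$ for all $B\in\mathcal A$, where $B^c=X\setminus B$. $\inf H(D)=\inf_{y\in D}H(y)$,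 $\sup H(D)=\sup_{y\in D}H(y)$ for $D\subset[0,\infty]$; $\inf H=\inf H([0,\infty])$, $\sup H=\sup H([0,\infty])$. Expressions such as $\inf H\circ b$ and $\sup H\circ b$ mean $(\inf H)\circ b$ and $(\sup H)\circ b$. *)

theory Defs
  imports "HOL-Analysis.Analysis"
begin

text \<open>
  Throughout, \<open>M :: 'a measure\<close> only serves as a measurable space: just \<open>space M\<close> and \<open>sets M\<close>
  are used, never \<open>emeasure M\<close>. The set function \<open>\<mu>\<close> is a separate, total function, of which only
  the values on \<open>sets M\<close> matter. The codomain \<open>[0,\<infinity>]\<close> is \<open>ennreal\<close>.
\<close>

definition monotone_measure :: "'a measure \<Rightarrow> ('a set \<Rightarrow> ennreal) \<Rightarrow> bool" where
  "monotone_measure M \<mu> \<longleftrightarrow>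
     \<mu> {} = 0 \<and> (\<forall>B\<in>sets M. \<forall>C\<in>sets M. B \<subseteq> C \<longrightarrow> \<mu> B \<le> \<mu> C)"

definition continuous_from_below :: "'a measure \<Rightarrow> ('a set \<Rightarrow> ennreal) \<Rightarrow> bool" where
  "continuous_from_below M \<mu> \<longleftrightarrow>
     (\<forall>S :: nat \<Rightarrow> 'a set. range S \<subseteq> sets M \<and> incseq S \<longrightarrow> (\<lambda>n. \<mu> (S n)) \<longlonglongrightarrow> \<mu> (\<Union>n. S n))"

text \<open>Unlike for \<open>\<sigma>\<close>-additive measures, no set of the sequence is required to have finite measure.\<close>

definition continuous_from_above :: "'a measure \<Rightarrow> ('a set \<Rightarrow> ennreal) \<Rightarrow> bool" where
  "continuous_from_above M \<mu> \<longleftrightarrow>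
     (\<forall>S :: nat \<Rightarrow> 'a set. range S \<subseteq> sets M \<and> decseq S \<longrightarrow> (\<lambda>n. \<mu> (S n)) \<longlonglongrightarrow> \<mu> (\<Inter>n. S n))"

definition continuous_monotone_measure :: "'a measure \<Rightarrow> ('a set \<Rightarrow> ennreal) \<Rightarrow> bool" where
  "continuous_monotone_measure M \<mu> \<longleftrightarrow>
     monotone_measure M \<mu> \<and> continuous_from_below M \<mu> \<and> continuous_from_above M \<mu>"

definition nondecreasing_map :: "(ennreal \<Rightarrow> ennreal \<Rightarrow> ennreal) \<Rightarrow> bool" where
  "nondecreasing_map circ \<longleftrightarrow> (\<forall>a b c d. a \<le> c \<and> b \<le> d \<longrightarrow> circ a b \<le> circ c d)"

text \<open>The supremum ranges over all \<open>t \<in> [0,\<infinity>]\<close>, including \<open>t = \<infinity>\<close>.\<close>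

definition gen_sugeno_integral ::
  "'a measure \<Rightarrow> (ennreal \<Rightarrow> ennreal \<Rightarrow> ennreal) \<Rightarrow> ('a set \<Rightarrow> ennreal) \<Rightarrow> 'a set \<Rightarrow> ('a \<Rightarrow> ennreal) \<Rightarrow> ennreal"
where
  "gen_sugeno_integral M circ \<mu> A g = (SUP t. circ t (\<mu> (A \<inter> {x \<in> space M. g x \<ge> t})))"

definition sugeno_integral ::
  "'a measure \<Rightarrow> ('a set \<Rightarrow> ennreal) \<Rightarrow> 'a set \<Rightarrow> ('a \<Rightarrow> ennreal) \<Rightarrow> ennreal"
where
  "sugeno_integral M \<mu> A g = (SUP t. min t (\<mu> (A \<inter> {x \<in> space M. g x \<ge> t})))"

definition weakly_subadditive_on :: "'a measure \<Rightarrow> ('a set \<Rightarrow> ennreal) \<Rightarrow> 'a set \<Rightarrow> bool" where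
  "weakly_subadditive_on M \<mu> A \<longleftrightarrow> (\<forall>B\<in>sets M. \<mu> A \<le> \<mu> (A \<inter> B) + \<mu> (A \<inter> (space M - B)))"

definition weakly_superadditive_on :: "'a measure \<Rightarrow> ('a set \<Rightarrow> ennreal) \<Rightarrow> 'a set \<Rightarrow> bool" where
  "weakly_superadditive_on M \<mu> A \<longleftrightarrow> (\<forall>B\<in>sets M. \<mu> A \<ge> \<mu> (A \<inter> B) + \<mu> (A \<inter> (space M - B)))"

end

theory Submission
  imports Defs
begin

text \<open>
  Two facts about the threshold \<open>p = Su(f; A, \<mu>)\<close> carry the argument. Continuity from above gives
  \<open>\<mu>(A \<inter> {f \<ge> p}) \<ge> p\<close>, and continuity from below together with \<open>p < \<infinity>\<close> gives \<open>\<mu>(A \<inter> {f > p}) \<le> p\<close>.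
  On each side of the threshold \<open>H(f)\<close> is bounded by the extrema of \<open>H\<close> on \<open>[0,p]\<close> and \<open>[p,\<infinity>]\<close>, and
  weak sub- or superadditivity converts the two facts into estimates for \<open>\<mu>(A \<inter> {f \<le> p})\<close> and
  \<open>\<mu>(A \<inter> {f < p})\<close>. For the equality cases, a function that is constant \<open>c\<close> on \<open>A\<close> has integral
  \<open>c \<circ> \<mu>(A)\<close>, and its threshold is \<open>min c (\<mu>(A))\<close>.
\<close>

lemma monotone_measure_empty: "monotone_measure M \<mu> \<Longrightarrow> \<mu> {} = 0"
  by (simp add: monotone_measure_def)

lemma monotone_measure_mono:
  "monotone_measure M \<mu> \<Longrightarrow> B \<in> sets M \<Longrightarrow> C \<in> sets M \<Longrightarrow> B \<subseteq> C \<Longrightarrow> \<mu> B \<le> \<mu> C"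
  by (simp add: monotone_measure_def)

lemma nondecreasing_mapD:
  "nondecreasing_map circ \<Longrightarrow> a \<le> c \<Longrightarrow> b \<le> d \<Longrightarrow> circ a b \<le> circ c d"
  by (simp add: nondecreasing_map_def)

text \<open>Since \<open>min\<close> is itself nondecreasing with \<open>min a 0 = 0\<close>, the
  general level-set bounds also compute the threshold of a function constant on
  \<open>A\<close>.\<close>

lemma sugeno_integral_eq_gen: "sugeno_integral M \<mu> A g = gen_sugeno_integral M min \<mu> A g"
  by (simp add: sugeno_integral_def gen_sugeno_integral_def)

text \<open>A single level suffices: at t = \<open>a\<close> the superlevel set within
  \<open>A\<close> contains \<open>B\<close>, so monotonicity bounds that one term of the
  supremum.\<close>

lemma gen_sugeno_integral_lower:
  assumes "monotone_measure M \<mu>" "nondecreasing_map circ" "g \<in> borel_measurable M"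
    and "A \<in> sets M" "B \<in> sets M" "B \<subseteq> A" "\<And>x. x \<in> B \<Longrightarrow> a \<le> g x" "b \<le> \<mu> B"
  shows "circ a b \<le> gen_sugeno_integral M circ \<mu> A g"
proof -
  have "B \<subseteq> A \<inter> {x \<in> space M. a \<le> g x}"
    using assms(5-7) sets.sets_into_space by blast
  moreover have "A \<inter> {x \<in> space M. a \<le> g x} \<in> sets M"
    using assms(3,4) by measurable
  ultimately have "b \<le> \<mu> (A \<inter> {x \<in> space M. a \<le> g x})"
    using monotone_measure_mono[OF assms(1,5)] by (blast intro: order_trans[OF assms(8)])
  then have "circ a b \<le> circ a (\<mu> (A \<inter> {x \<in> space M. a \<le> g x}))"
    by (intro nondecreasing_mapD[OF assms(2)]) auto
  also have "\<dots> \<le> gen_sugeno_integral M circ \<mu> A g"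
    unfolding gen_sugeno_integral_def by (rule SUP_upper) simp
  finally show ?thesis .
qed

text \<open>Here \<open>B\<close> is the exceptional set on which only the cruder bound
  \<open>c\<close> is available. Levels up to \<open>a\<close> are charged to all of
  \<open>A\<close>; levels between \<open>a\<close> and \<open>c\<close> have superlevel sets inside
  \<open>B\<close>; beyond \<open>c\<close> these sets are empty and the term vanishes by
  \<open>circ a 0 = 0\<close>.\<close>

lemma gen_sugeno_integral_upper:
  assumes "monotone_measure M \<mu>" "nondecreasing_map circ" "\<And>a. circ a 0 = 0"
    and "g \<in> borel_measurable M" "A \<in> sets M" "B \<in> sets M"
    and "\<And>x. x \<in> A - B \<Longrightarrow> g x \<le> a" "\<And>x. x \<in> A \<Longrightarrow> g x \<le> c" "\<mu> B \<le> b"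
  shows "gen_sugeno_integral M circ \<mu> A g \<le> max (circ a (\<mu> A)) (circ c b)"
  unfolding gen_sugeno_integral_def
proof (rule SUP_least)
  fix t
  let ?L = "A \<inter> {x \<in> space M. t \<le> g x}"
  have L: "?L \<in> sets M"
    using assms(4,5) by measurable
  consider "t \<le> a" | "a < t" "t \<le> c" | "c < t"
    by fastforce
  then show "circ t (\<mu> ?L) \<le> max (circ a (\<mu> A)) (circ c b)"
  proof cases
    case 1
    have "\<mu> ?L \<le> \<mu> A"
      using assms(1,5) L by (intro monotone_measure_mono) auto
    with 1 show ?thesis
      using nondecreasing_mapD[OF assms(2)] by (simp add: le_max_iff_disj)
  next
    case 2
    have "?L \<subseteq> B"
      using assms(7) 2(1) by fastforce
    then have "\<mu> ?L \<le> b"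
      using monotone_measure_mono[OF assms(1) L assms(6)] assms(9) order_trans by blast
    with 2 show ?thesis
      using nondecreasing_mapD[OF assms(2)] by (simp add: le_max_iff_disj)
  next
    case 3
    then have "?L = {}"
      using assms(8) by fastforce
    then show ?thesis
      using assms(1,3) by (simp add: monotone_measure_empty)
  qed
qed

lemma gen_sugeno_integral_const_on:
  assumes "monotone_measure M \<mu>" "nondecreasing_map circ" "\<And>a. circ a 0 = 0"
    and "g \<in> borel_measurable M" "A \<in> sets M" "\<And>x. x \<in> A \<Longrightarrow> g x = c"
  shows "gen_sugeno_integral M circ \<mu> A g = circ c (\<mu> A)"
proof (rule antisym)
  show "gen_sugeno_integral M circ \<mu> A g \<le> circ c (\<mu> A)"
    using gen_sugeno_integral_upper[of M \<mu> circ g A A c c "\<mu> A"] assms by simp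
  show "circ c (\<mu> A) \<le> gen_sugeno_integral M circ \<mu> A g"
    using assms by (intro gen_sugeno_integral_lower[of M \<mu> circ g A A]) auto
qed

lemma sugeno_integral_const_on:
  assumes "monotone_measure M \<mu>" "g \<in> borel_measurable M" "A \<in> sets M" "\<And>x. x \<in> A \<Longrightarrow> g x = c"
  shows "sugeno_integral M \<mu> A g = min c (\<mu> A)"
  unfolding sugeno_integral_eq_gen
  by (rule gen_sugeno_integral_const_on[OF assms(1) _ _ assms(2-4)])
    (auto simp: nondecreasing_map_def min_le_iff_disj)

text \<open>As t increases to \<open>p\<close>, the sets {f \<ge> t} shrink to {f \<ge> p}, so
  continuity from above applies along any increasing sequence of levels.\<close>

lemma tendsto_superlevel_at_left:
  fixes p :: ennreal
  assumes "continuous_from_above M \<mu>" "f \<in> borel_measurable M" "A \<in> sets M" "0 < p"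
  shows "((\<lambda>t. \<mu> (A \<inter> {x \<in> space M. t \<le> f x})) \<longlongrightarrow> \<mu> (A \<inter> {x \<in> space M. p \<le> f x})) (at_left p)"
proof (rule tendsto_at_left_sequentially[OF assms(4)])
  fix u :: "nat \<Rightarrow> ennreal"
  assume u: "\<And>n. u n < p" "incseq u" "u \<longlonglongrightarrow> p"
  let ?S = "\<lambda>n. A \<inter> {x \<in> space M. u n \<le> f x}"
  have "(\<Inter>n. ?S n) = A \<inter> {x \<in> space M. p \<le> f x}"
    by (auto intro: LIMSEQ_le_const2[OF u(3)] order_trans[OF less_imp_le[OF u(1)]])
  moreover have "decseq ?S"
    using incseqD[OF u(2)] order_trans by (fastforce simp: decseq_def)
  moreover have "range ?S \<subseteq> sets M"
    using assms(2,3) by auto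
  ultimately show "(\<lambda>n. \<mu> (?S n)) \<longlonglongrightarrow> \<mu> (A \<inter> {x \<in> space M. p \<le> f x})"
    using assms(1)[unfolded continuous_from_above_def, rule_format, of ?S] by simp
qed

text \<open>Levels strictly above \<open>p\<close> exhaust only the points with f >
  \<open>p\<close>, which is why the limit set carries a strict inequality.\<close>

lemma tendsto_superlevel_at_right:
  fixes p :: ennreal
  assumes "continuous_from_below M \<mu>" "f \<in> borel_measurable M" "A \<in> sets M" "p < \<infinity>"
  shows "((\<lambda>t. \<mu> (A \<inter> {x \<in> space M. t \<le> f x})) \<longlongrightarrow> \<mu> (A \<inter> {x \<in> space M. p < f x})) (at_right p)"
proof (rule tendsto_at_right_sequentially[OF assms(4)])
  fix u :: "nat \<Rightarrow> ennreal"
  assume u: "\<And>n. p < u n" "decseq u" "u \<longlonglongrightarrow> p"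
  let ?S = "\<lambda>n. A \<inter> {x \<in> space M. u n \<le> f x}"
  have "\<exists>n. u n \<le> y" if "p < y" for y
    using order_tendstoD(2)[OF u(3) that] by (auto simp: eventually_sequentially intro: less_imp_le)
  then have "(\<Union>n. ?S n) = A \<inter> {x \<in> space M. p < f x}"
    using u(1) by (auto intro: less_le_trans)
  moreover have "incseq ?S"
    using decseqD[OF u(2)] order_trans by (fastforce simp: incseq_def)
  moreover have "range ?S \<subseteq> sets M"
    using assms(2,3) by auto
  ultimately show "(\<lambda>n. \<mu> (?S n)) \<longlonglongrightarrow> \<mu> (A \<inter> {x \<in> space M. p < f x})"
    using assms(1)[unfolded continuous_from_below_def, rule_format, of ?S] by simp
qed

text \<open>Any t below the supremum is beaten by the term at some level s > t, so the larger set {f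
  \<ge> t} has measure above t; then t tends to the threshold from the left. Threshold 0 is split
  off because no levels lie below it.\<close>

lemma sugeno_integral_le_measure_ge:
  assumes "monotone_measure M \<mu>" "continuous_from_above M \<mu>" "f \<in> borel_measurable M" "A \<in> sets M"
  shows "sugeno_integral M \<mu> A f \<le> \<mu> (A \<inter> {x \<in> space M. sugeno_integral M \<mu> A f \<le> f x})"
proof (cases "sugeno_integral M \<mu> A f = 0")
  case False
  define p where "p = sugeno_integral M \<mu> A f"
  have p: "0 < p"
    using False by (simp add: p_def zero_less_iff_neq_zero)
  have *: "t \<le> \<mu> (A \<inter> {x \<in> space M. t \<le> f x})" if t: "t < p" for t
  proof -
    obtain s where s: "t < min s (\<mu> (A \<inter> {x \<in> space M. s \<le> f x}))"
      using t unfolding p_def sugeno_integral_def less_SUP_iff by blast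
    moreover have "\<mu> (A \<inter> {x \<in> space M. s \<le> f x}) \<le> \<mu> (A \<inter> {x \<in> space M. t \<le> f x})"
      using assms(3,4) s by (intro monotone_measure_mono[OF assms(1)]) auto
    ultimately show ?thesis
      by auto
  qed
  have "p \<le> \<mu> (A \<inter> {x \<in> space M. p \<le> f x})"
  proof (rule tendsto_le[OF _ tendsto_superlevel_at_left[OF assms(2-4) p] tendsto_ident_at])
    show "at_left p \<noteq> bot"
      using p by (auto simp: trivial_limit_def eventually_at_left dest: dense)
    show "\<forall>\<^sub>F t in at_left p. t \<le> \<mu> (A \<inter> {x \<in> space M. t \<le> f x})"
      using * by (simp add: eventually_at_filter)
  qed
  then show ?thesis
    by (simp add: p_def)
qed simp

text \<open>For t above the threshold p, the minimum of t and the measure of {f \<ge> t} is at most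
  p < t, so it is the measure that is at most p. Letting t decrease to p needs p finite, so that
  there are levels above it.\<close>

lemma measure_greater_le_sugeno_integral:
  assumes "continuous_from_below M \<mu>" "f \<in> borel_measurable M" "A \<in> sets M"
    and "sugeno_integral M \<mu> A f < \<infinity>"
  shows "\<mu> (A \<inter> {x \<in> space M. sugeno_integral M \<mu> A f < f x}) \<le> sugeno_integral M \<mu> A f"
proof (rule tendsto_upperbound[OF tendsto_superlevel_at_right[OF assms]])
  let ?p = "sugeno_integral M \<mu> A f"
  have "\<mu> (A \<inter> {x \<in> space M. t \<le> f x}) \<le> ?p" if "?p < t" for t
  proof -
    have "min t (\<mu> (A \<inter> {x \<in> space M. t \<le> f x})) \<le> ?p"
      unfolding sugeno_integral_def by (rule SUP_upper) simp
    with that show ?thesis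
      by (auto simp: min_le_iff_disj)
  qed
  then show "\<forall>\<^sub>F t in at_right ?p. \<mu> (A \<inter> {x \<in> space M. t \<le> f x}) \<le> ?p"
    by (simp add: eventually_at_filter)
  show "at_right ?p \<noteq> bot"
    using assms(4) by (auto simp: trivial_limit_def eventually_at_right dest: dense)
qed

theorem theorem2p3:
  fixes M :: "'a measure"
    and \<mu> :: "'a set \<Rightarrow> ennreal"
    and A :: "'a set"
    and circ :: "ennreal \<Rightarrow> ennreal \<Rightarrow> ennreal"
    and H :: "ennreal \<Rightarrow> ennreal"
    and f :: "'a \<Rightarrow> ennreal"
    and p :: ennreal
  assumes "continuous_monotone_measure M \<mu>"
    and "A \<in> sets M"
    and "nondecreasing_map circ"
    and "\<And>a. circ a 0 = 0"
    and "f \<in> borel_measurable M"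
    and "(\<lambda>x. H (f x)) \<in> borel_measurable M"
    and "p = sugeno_integral M \<mu> A f"
    and "p < \<infinity>"
  shows
    "(gen_sugeno_integral M circ \<mu> A (\<lambda>x. H (f x))
        \<ge> max (circ (INF y\<in>{p..\<infinity>}. H y) p) (circ (INF y. H y) (\<mu> A)))
     \<and> (gen_sugeno_integral M circ \<mu> A (\<lambda>x. H (f x))
        \<le> max (circ (SUP y\<in>{0..p}. H y) (\<mu> A)) (circ (SUP y. H y) p))
     \<and> ((\<forall>x\<in>space M. f x = \<mu> A * indicator A x) \<and> H p = (INF y\<in>{p..\<infinity>}. H y) \<longrightarrow>
          gen_sugeno_integral M circ \<mu> A (\<lambda>x. H (f x))
          = max (circ (INF y\<in>{p..\<infinity>}. H y) p) (circ (INF y. H y) (\<mu> A)))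
     \<and> (\<forall>y0. (\<forall>x\<in>space M. f x = y0 * indicator A x) \<and> H p = (SUP y\<in>{0..p}. H y)
               \<and> H y0 = (SUP y. H y) \<longrightarrow>
          gen_sugeno_integral M circ \<mu> A (\<lambda>x. H (f x))
          = max (circ (SUP y\<in>{0..p}. H y) (\<mu> A)) (circ (SUP y. H y) p))
     \<and> (weakly_subadditive_on M \<mu> A \<longrightarrow>
          (gen_sugeno_integral M circ \<mu> A (\<lambda>x. H (f x))
             \<ge> max (circ (INF y\<in>{0..p}. H y) (\<mu> A - p)) (circ (INF y. H y) (\<mu> A)))
          \<and> (\<forall>y0. (\<forall>x\<in>space M. f x = y0 * indicator A x) \<and> H p = (INF y\<in>{0..p}. H y)
                    \<and> H y0 = (INF y. H y) \<longrightarrow>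
               gen_sugeno_integral M circ \<mu> A (\<lambda>x. H (f x))
               = max (circ (INF y\<in>{0..p}. H y) (\<mu> A - p)) (circ (INF y. H y) (\<mu> A))))
     \<and> (weakly_superadditive_on M \<mu> A \<longrightarrow>
          (gen_sugeno_integral M circ \<mu> A (\<lambda>x. H (f x))
             \<le> max (circ (SUP y\<in>{p..\<infinity>}. H y) (\<mu> A)) (circ (SUP y. H y) (\<mu> A - p)))
          \<and> ((\<forall>x\<in>space M. f x = \<mu> A * indicator A x) \<and> H p = (SUP y\<in>{p..\<infinity>}. H y) \<longrightarrow>
               gen_sugeno_integral M circ \<mu> A (\<lambda>x. H (f x))
               = max (circ (SUP y\<in>{p..\<infinity>}. H y) (\<mu> A)) (circ (SUP y. H y) (\<mu> A - p))))"
proof -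
  let ?I = "gen_sugeno_integral M circ \<mu> A (\<lambda>x. H (f x))"
  note A = assms(2) and circ = assms(3) and circ0 = assms(4) and f = assms(5) and Hf = assms(6)
    and p = assms(7) and pfin = assms(8)
  have mono: "monotone_measure M \<mu>" and below: "continuous_from_below M \<mu>"
    and above: "continuous_from_above M \<mu>"
    using assms(1) by (simp_all add: continuous_monotone_measure_def)
  have ge: "p \<le> \<mu> (A \<inter> {x \<in> space M. p \<le> f x})"
    using sugeno_integral_le_measure_ge[OF mono above f A] p by simp
  have gr: "\<mu> (A \<inter> {x \<in> space M. p < f x}) \<le> p"
    using measure_greater_le_sugeno_integral[OF below f A] p pfin by simp
  have sets: "{x \<in> space M. p < f x} \<in> sets M" "{x \<in> space M. p \<le> f x} \<in> sets M"
    "{x \<in> space M. f x < p} \<in> sets M" "{x \<in> space M. f x \<le> p} \<in> sets M"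
    using f by measurable
  note Asets = sets[THEN sets.Int[OF A]]
  have AX: "x \<in> space M" if "x \<in> A" for x
    using that A sets.sets_into_space by blast
  note lower = gen_sugeno_integral_lower[OF mono circ Hf A]
  note upper = gen_sugeno_integral_upper[OF mono circ circ0 Hf A]
  \<comment> \<open>All equality cases reduce to these two values, with \<open>c\<close> either
    \<open>\<mu> A\<close>, which forces \<open>p = \<mu> A\<close>, or \<open>y0\<close>.\<close>
  have const: "?I = circ (H c) (\<mu> A)" "p = min c (\<mu> A)"
    if "\<forall>x\<in>space M. f x = c * indicator A x" for c
  proof -
    have fc: "f x = c" if "x \<in> A" for x
      using that AX \<open>\<forall>x\<in>space M. f x = c * indicator A x\<close> by simp
    show "?I = circ (H c) (\<mu> A)"
      using fc by (intro gen_sugeno_integral_const_on[OF mono circ circ0 Hf A]) simp_all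
    show "p = min c (\<mu> A)"
      unfolding p using fc by (intro sugeno_integral_const_on[OF mono f A])
  qed
  have inf: "circ (INF y. H y) (\<mu> A) \<le> ?I"
    using A by (intro lower[of A]) (auto intro: INF_lower)
  have inf_le: "circ (INF y. H y) b \<le> circ (H y) d" if "b \<le> d" for y b d
    using that by (intro nondecreasing_mapD[OF circ]) (auto intro: INF_lower)
  have le_sup: "circ (H y) b \<le> circ (SUP y. H y) d" if "b \<le> d" for y b d
    using that by (intro nondecreasing_mapD[OF circ]) (auto intro: SUP_upper)

  have i1: "max (circ (INF y\<in>{p..\<infinity>}. H y) p) (circ (INF y. H y) (\<mu> A)) \<le> ?I"
    using inf ge Asets by (auto intro!: lower[of "A \<inter> {x \<in> space M. p \<le> f x}"] INF_lower)
  have i2: "?I \<le> max (circ (SUP y\<in>{0..p}. H y) (\<mu> A)) (circ (SUP y. H y) p)"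
    \<comment> \<open>Outside the exceptional set {f > p}, of measure at most \<open>p\<close>, the
      values of \<open>f\<close> lie in [0,p].\<close>
    using gr Asets AX
    by (intro upper[of "A \<inter> {x \<in> space M. p < f x}"]) (auto intro!: SUP_upper)
  have i1_eq: "?I = max (circ (INF y\<in>{p..\<infinity>}. H y) p) (circ (INF y. H y) (\<mu> A))"
    if c: "\<forall>x\<in>space M. f x = \<mu> A * indicator A x" and h: "H p = (INF y\<in>{p..\<infinity>}. H y)"
    using const[OF c] inf_le[of p p p] unfolding h[symmetric] by (simp add: max_absorb1)
  have i2_eq: "?I = max (circ (SUP y\<in>{0..p}. H y) (\<mu> A)) (circ (SUP y. H y) p)"
    if c: "\<forall>x\<in>space M. f x = y0 * indicator A x" and h: "H p = (SUP y\<in>{0..p}. H y)"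
      and m: "H y0 = (SUP y. H y)" for y0
  \<comment> \<open>The case decides which term attains the maximum: the first when
    \<open>p = y0\<close>, the second when \<open>p = \<mu> A\<close>.\<close>
  proof (cases "y0 \<le> \<mu> A")
    case True
    then have "p = y0"
      using const(2)[OF c] by simp
    then show ?thesis
      using const(1)[OF c] True nondecreasing_mapD[OF circ, of "H y0" "H y0" y0 "\<mu> A"]
      unfolding h[symmetric] m[symmetric] by (simp add: max_absorb1)
  next
    case False
    then have "p = \<mu> A"
      using const(2)[OF c] by simp
    then show ?thesis
      using const(1)[OF c] le_sup[of p p p]
      unfolding h[symmetric] m by (simp add: max_absorb2)
  qed

  have ii: "max (circ (INF y\<in>{0..p}. H y) (\<mu> A - p)) (circ (INF y. H y) (\<mu> A)) \<le> ?I"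
    if sub: "weakly_subadditive_on M \<mu> A"
  proof -
    have "A \<inter> (space M - {x \<in> space M. p < f x}) = A \<inter> {x \<in> space M. f x \<le> p}"
      by auto
    then have "\<mu> A \<le> \<mu> (A \<inter> {x \<in> space M. p < f x}) + \<mu> (A \<inter> {x \<in> space M. f x \<le> p})"
      using sub sets(1) unfolding weakly_subadditive_on_def by metis
    also have "\<dots> \<le> p + \<mu> (A \<inter> {x \<in> space M. f x \<le> p})"
      using gr by (rule add_right_mono)
    finally have "\<mu> A - p \<le> \<mu> (A \<inter> {x \<in> space M. f x \<le> p})"
      \<comment> \<open>Finiteness of \<open>p\<close> excludes the difference of two infinities,
        which is infinite in \<open>ennreal\<close>.\<close>
      using pfin by (auto simp: ennreal_minus_le_iff)
    then show ?thesis
      using inf Asets by (auto intro!: lower[of "A \<inter> {x \<in> space M. f x \<le> p}"] INF_lower)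
  qed
  have ii_eq: "?I = max (circ (INF y\<in>{0..p}. H y) (\<mu> A - p)) (circ (INF y. H y) (\<mu> A))"
    if c: "\<forall>x\<in>space M. f x = y0 * indicator A x" and h: "H p = (INF y\<in>{0..p}. H y)"
      and m: "H y0 = (INF y. H y)" for y0
  proof (cases "y0 \<le> \<mu> A")
    case True
    then have "p = y0"
      using const(2)[OF c] by simp
    then show ?thesis
      using const(1)[OF c] nondecreasing_mapD[OF circ, of "H y0" "H y0" "\<mu> A - y0" "\<mu> A"]
      unfolding h[symmetric] m[symmetric] by (simp add: max_absorb2)
  next
    case False
    then have "p = \<mu> A"
      using const(2)[OF c] by simp
    then show ?thesis
      \<comment> \<open>Now \<open>\<mu> A - p\<close> is 0, as \<open>p\<close> is finite, and the
        first term vanishes.\<close>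
      using const(1)[OF c] pfin circ0 unfolding h[symmetric] m by simp
  qed

  have iii: "?I \<le> max (circ (SUP y\<in>{p..\<infinity>}. H y) (\<mu> A)) (circ (SUP y. H y) (\<mu> A - p))"
    if super: "weakly_superadditive_on M \<mu> A"
  proof -
    have "A \<inter> (space M - {x \<in> space M. p \<le> f x}) = A \<inter> {x \<in> space M. f x < p}"
      by auto
    then have "\<mu> (A \<inter> {x \<in> space M. p \<le> f x}) + \<mu> (A \<inter> {x \<in> space M. f x < p}) \<le> \<mu> A"
      using super sets(2) unfolding weakly_superadditive_on_def by metis
    then have "p + \<mu> (A \<inter> {x \<in> space M. f x < p}) \<le> \<mu> A"
      using add_right_mono[OF ge] order_trans by blast
    then have "\<mu> (A \<inter> {x \<in> space M. f x < p}) \<le> \<mu> A - p"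
      using ennreal_minus_mono[OF _ order_refl] pfin ennreal_add_diff_cancel_left
      by (metis infinity_ennreal_def less_irrefl)
    then show ?thesis
      \<comment> \<open>The roles are reversed compared with the first upper bound: the exceptional
        set is {f < p}, and outside it \<open>f\<close> takes values in [p,\<infinity>].\<close>
      using Asets AX
      by (intro upper[of "A \<inter> {x \<in> space M. f x < p}"]) (auto intro!: SUP_upper)
  qed
  have iii_eq: "?I = max (circ (SUP y\<in>{p..\<infinity>}. H y) (\<mu> A)) (circ (SUP y. H y) (\<mu> A - p))"
    if c: "\<forall>x\<in>space M. f x = \<mu> A * indicator A x" and h: "H p = (SUP y\<in>{p..\<infinity>}. H y)"
    \<comment> \<open>With \<open>p = \<mu> A\<close> finite, the difference is 0, so only the first
      term survives.\<close>
    using const[OF c] pfin circ0 unfolding h[symmetric] by simp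

  show ?thesis
    using i1 i2 i1_eq i2_eq ii ii_eq iii iii_eq by blast
qed

end
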